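(* Let $T[1..n] = S_1 \cdot S_2 \cdots S_d$ be the concatenation of documents $S_j$, $\mathsf{SA}$ its suffix array and $\mathsf{DA}$ its document array. Let $\mathsf{SA}[\ell..r]$ be the interval that contains the starting positions of the suffixes of $T$ prefixed by a pattern $P[1..m]$. Then the leftmost occurrences of the distinct document identifiers in $\mathsf{DA}[\ell..r]$ are in the same positions as the values strictly less than $m$ in $\mathsf{ILCP}[\ell..r]$. That is, for every $k$ with $\ell\le k\le r$, we have $\mathsf{ILCP}[k]<m$ if and only if $\mathsf{DA}[k']\neq \mathsf{DA}[k]$ for all $\ell\le k'<k$.
   Context: Strings are indexed from 1. Each document $S_j$ is a string over an ordered alphabet terminated with a special symbol $\$$, which is lexicographically smaller than every other symbol and occurs in $S_j$ only as its last symbol. Patterns $P[1..m]$, $m\ge 1$, are strings not containing $\$$. The suffix array $\mathsf{SA}[1..n]$ of $T$ is the permutation of $\{1,\dots,n\}$ with $T[\mathsf{SA}[i]..n] < T[\mathsf{SA}[i+1]..n]$ lexicographically for all $1\le i<n$. The suffix array $\mathsf{SA}_{S}$ of a string $S$ is defined in the same way. The interval $\mathsf{SA}[\ell..r]$ of a pattern $P$ contains exactly the starting positions of all suffixes of $T$ having $P$ as a prefix. The document array $\mathsf{DA}[1..n]$ is defined by letting $\mathsf{DA}[i]$ be the index $j$ of the document $S_j$ containing position $\mathsf{SA}[i]$ of $T$. For a sequence $X$, $\mathsf{rank}_c(X,i)$ is the number of occurrences of $c$ in $X[1..i]$. The longest-common-prefix array $\mathsf{LCP}_S[1..|S|]$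 of a string $S$ has $\mathsf{LCP}_S[1]=0$ and, for $2\le i\le |S|$, $\mathsf{LCP}_S[i]$ is the length of the longest common prefix of $S[\mathsf{SA}_S[i-1]..|S|]$ and $S[\mathsf{SA}_S[i]..|S|]$. The interleaved LCP array of $T$ is defined for $1\le i\le n$ by $$\mathsf{ILCP}[i] = \mathsf{LCP}_{S_{\mathsf{DA}[i]}}\bigl[\mathsf{rank}_{\mathsf{DA}[i]}(\mathsf{DA},i)\bigr].$$ *)

theory Defs
  imports Main "HOL-Library.Sublist" "HOL-Library.List_Lexorder"
begin

text \<open>
  Strings and arrays are lists, read with indices starting from 1. The order \<open><\<close> on lists is
  the lexicographic order of \<open>List_Lexorder\<close>, in which a proper prefix is smaller.
\<close>

definition nth1 :: "'b list \<Rightarrow> nat \<Rightarrow> 'b"  (infixl \<open>!\<^sub>1\<close> 100) where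
  "xs !\<^sub>1 i = xs ! (i - 1)"

text \<open>\<open>suffix_from S i\<close> is \<open>S[i..|S|]\<close>.\<close>

definition suffix_from :: "'b list \<Rightarrow> nat \<Rightarrow> 'b list" where
  "suffix_from S i = drop (i - 1) S"

definition is_document :: "'a \<Rightarrow> 'a list \<Rightarrow> bool" where
  "is_document dollar S \<longleftrightarrow> (\<exists>w. dollar \<notin> set w \<and> S = w @ [dollar])"

definition is_suffix_array :: "'a::linorder list \<Rightarrow> nat list \<Rightarrow> bool" where
  "is_suffix_array S sa \<longleftrightarrow>
     distinct sa \<and> set sa = {1..length S} \<and>
     (\<forall>i. 1 \<le> i \<and> i < length S \<longrightarrow> suffix_from S (sa !\<^sub>1 i) < suffix_from S (sa !\<^sub>1 (i + 1)))"

definition suffix_array :: "'a::linorder list \<Rightarrow> nat list" where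
  "suffix_array S = (THE sa. is_suffix_array S sa)"

definition is_sa_interval :: "'a::linorder list \<Rightarrow> 'a list \<Rightarrow> nat \<Rightarrow> nat \<Rightarrow> bool" where
  "is_sa_interval T P l r \<longleftrightarrow>
     1 \<le> l \<and> r \<le> length T \<and>
     {suffix_array T !\<^sub>1 k | k. l \<le> k \<and> k \<le> r} =
     {p. 1 \<le> p \<and> p \<le> length T \<and> prefix P (suffix_from T p)}"

text \<open>The index of the document that contains position \<open>p\<close> of the concatenation.\<close>

definition doc_of :: "'a list list \<Rightarrow> nat \<Rightarrow> nat" where
  "doc_of docs p = (THE j. 1 \<le> j \<and> j \<le> length docs \<and>
     length (concat (take (j - 1) docs)) < p \<and> p \<le> length (concat (take j docs)))"

definition document_array :: "'a::linorder list list \<Rightarrow> nat list" where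
  "document_array docs = map (doc_of docs) (suffix_array (concat docs))"

definition rank :: "'b \<Rightarrow> 'b list \<Rightarrow> nat \<Rightarrow> nat" where
  "rank c X i = count_list (take i X) c"

definition lcp_array :: "'a::linorder list \<Rightarrow> nat list" where
  "lcp_array S = map (\<lambda>i. if i = 1 then 0
     else length (longest_common_prefix
            (suffix_from S (suffix_array S !\<^sub>1 (i - 1)))
            (suffix_from S (suffix_array S !\<^sub>1 i)))) [1..<length S + 1]"

definition ilcp_array :: "'a::linorder list list \<Rightarrow> nat list" where
  "ilcp_array docs = map (\<lambda>i. let j = document_array docs !\<^sub>1 i
     in lcp_array (docs !\<^sub>1 j) !\<^sub>1 rank j (document_array docs) i) [1..<length (concat docs) + 1]"

text \<open>The definite descriptions above are well defined.\<close>

lemma suffix_from_inj: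
  assumes "i \<in> {1..length S}" "j \<in> {1..length S}" "suffix_from S i = suffix_from S j"
  shows "i = j"
proof -
  have "length (suffix_from S i) = length (suffix_from S j)" using assms(3) by simp
  then show ?thesis using assms(1,2) by (auto simp: suffix_from_def)
qed

lemma is_suffix_array_iff:
  "is_suffix_array S sa \<longleftrightarrow>
     distinct sa \<and> set sa = {1..length S} \<and> sorted_wrt (<) (map (suffix_from S) sa)"
proof -
  have *: "sorted_wrt (<) (map (suffix_from S) sa) \<longleftrightarrow>
      (\<forall>i. 1 \<le> i \<and> i < length S \<longrightarrow> suffix_from S (sa !\<^sub>1 i) < suffix_from S (sa !\<^sub>1 (i + 1)))"
    if "length sa = length S"
  proof -
    have "sorted_wrt (<) (map (suffix_from S) sa) \<longleftrightarrow>
      (\<forall>i. Suc i < length S \<longrightarrow> suffix_from S (sa ! i) < suffix_from S (sa ! Suc i))"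
      using that by (subst sorted_wrt_iff_nth_Suc_transp) (auto intro: transpI)
    also have "\<dots> \<longleftrightarrow>
      (\<forall>i. 1 \<le> i \<and> i < length S \<longrightarrow> suffix_from S (sa !\<^sub>1 i) < suffix_from S (sa !\<^sub>1 (i + 1)))"
    proof (intro iffI allI impI)
      fix i
      assume "\<forall>i. Suc i < length S \<longrightarrow> suffix_from S (sa ! i) < suffix_from S (sa ! Suc i)"
        and "1 \<le> i \<and> i < length S"
      then show "suffix_from S (sa !\<^sub>1 i) < suffix_from S (sa !\<^sub>1 (i + 1))"
        by (cases i) (auto simp: nth1_def)
    next
      fix i
      assume *: "\<forall>i. 1 \<le> i \<and> i < length S \<longrightarrow> suffix_from S (sa !\<^sub>1 i) < suffix_from S (sa !\<^sub>1 (i + 1))"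
        and "Suc i < length S"
      then show "suffix_from S (sa ! i) < suffix_from S (sa ! Suc i)"
        using *[rule_format, of "Suc i"] by (simp add: nth1_def)
    qed
    finally show ?thesis .
  qed
  have "length sa = length S" if "distinct sa" "set sa = {1..length S}"
    using distinct_card[OF that(1)] that(2) by simp
  with * show ?thesis unfolding is_suffix_array_def by blast
qed

lemma ex1_suffix_array: "\<exists>!sa. is_suffix_array S sa"
proof (rule ex_ex1I)
  let ?sa = "sort_key (suffix_from S) [1..<length S + 1]"
  have set: "set ?sa = {1..length S}" by auto
  have "distinct (map (suffix_from S) ?sa)"
    using suffix_from_inj[of _ S] set by (auto simp: distinct_map inj_on_def)
  moreover have "sorted (map (suffix_from S) ?sa)" by simp
  ultimately have "sorted_wrt (<) (map (suffix_from S) ?sa)"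
    by (simp only: strict_sorted_iff)
  then show "\<exists>sa. is_suffix_array S sa"
    unfolding is_suffix_array_iff using set by (metis distinct_sort distinct_upt)
next
  fix sa sb assume a: "is_suffix_array S sa" and b: "is_suffix_array S sb"
  have "map (suffix_from S) sa = map (suffix_from S) sb"
    using a b unfolding is_suffix_array_iff by (intro strict_sorted_equal) auto
  moreover have "inj_on (suffix_from S) (set sa \<union> set sb)"
    using a b suffix_from_inj[of _ S] unfolding is_suffix_array_iff inj_on_def by auto
  ultimately show "sa = sb" by (metis map_inj_on)
qed

lemma is_suffix_array_suffix_array: "is_suffix_array S (suffix_array S)"
  unfolding suffix_array_def by (rule theI'[OF ex1_suffix_array])

lemma ex1_doc_of:
  assumes "1 \<le> p" "p \<le> length (concat docs)"
  shows "\<exists>!j. 1 \<le> j \<and> j \<le> length docs \<and>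
     length (concat (take (j - 1) docs)) < p \<and> p \<le> length (concat (take j docs))"
proof (rule ex_ex1I)
  let ?Q = "\<lambda>j. p \<le> length (concat (take j docs))"
  let ?j = "LEAST j. ?Q j"
  have Q: "?Q (length docs)" using assms by simp
  have "?Q ?j" using Q by (rule LeastI)
  moreover have "?j \<le> length docs" using Q by (rule Least_le)
  moreover have "?j \<noteq> 0" 
  proof
    assume "?j = 0"
    with \<open>?Q ?j\<close> assms(1) show False by (simp only: take_0 concat.simps list.size)
  qed
  moreover from this have "\<not> ?Q (?j - 1)" by (intro not_less_Least) simp
  ultimately show "\<exists>j. 1 \<le> j \<and> j \<le> length docs \<and>
     length (concat (take (j - 1) docs)) < p \<and> ?Q j"
    by (intro exI[of _ ?j]) auto
next
  fix i j
  assume *: "1 \<le> i \<and> i \<le> length docs \<and>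
     length (concat (take (i - 1) docs)) < p \<and> p \<le> length (concat (take i docs))"
    "1 \<le> j \<and> j \<le> length docs \<and>
     length (concat (take (j - 1) docs)) < p \<and> p \<le> length (concat (take j docs))"
  have mono: "length (concat (take a docs)) \<le> length (concat (take b docs))" if "a \<le> b" for a b
  proof -
    have "take b docs = take a docs @ take (b - a) (drop a docs)"
      using that by (metis le_add_diff_inverse take_add)
    then show ?thesis by simp
  qed
  show "i = j"
  proof (cases i j rule: linorder_cases)
    case less
    then have "length (concat (take i docs)) \<le> length (concat (take (j - 1) docs))"
      by (intro mono) simp
    with * show ?thesis by linarith
  next
    case greater
    then have "length (concat (take j docs)) \<le> length (concat (take (i - 1) docs))"
      by (intro mono) simp
    with * show ?thesis by linarith
  qed
qed

end

theory Submission
  imports Defs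
begin

text \<open>
  Suffixes of a document end in their only \<open>$\<close>, so none of them is a proper prefix of another.
  Hence the suffixes of \<open>T\<close> that start in \<open>S\<^sub>j\<close> are ordered as the corresponding suffixes of \<open>S\<^sub>j\<close>,
  and the subsequence of \<open>SA\<close> with \<open>DA[k] = j\<close> is the suffix array of \<open>S\<^sub>j\<close>, shifted. Therefore
  \<open>ILCP[k]\<close> compares the suffix at \<open>SA[k]\<close> with the one at \<open>SA[k\<^sub>0]\<close>, where \<open>k\<^sub>0\<close> is the previous
  position with \<open>DA[k\<^sub>0] = DA[k]\<close>. As \<open>P\<close> is a prefix of the former, it is also a prefix
  of the latter, that is \<open>\<ell> \<le> k\<^sub>0\<close>, exactly if \<open>ILCP[k] \<ge> m\<close>. If there is no such \<open>k\<^sub>0\<close>,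
  then \<open>ILCP[k] = 0 < m\<close>.
\<close>

section \<open>Lists: order, common prefixes and ranks\<close>

text \<open>The first mismatch lies inside both \<open>u\<close> and \<open>v\<close>, so it decides
  the comparison whatever the tails are.\<close>

lemma append_less_append_imp_less:
  fixes u v x y :: "'a::linorder list"
  assumes "\<not> prefix u v" "\<not> prefix v u" "u @ x < v @ y"
  shows "u < v"
  using assms by (induction u v rule: list_induct2') auto

text \<open>\<open>P\<close> and the longest common prefix are both prefixes of \<open>v\<close>, so
  the shorter is a prefix of the other; and every common prefix is a prefix of the longest
  one.\<close>

lemma length_longest_common_prefix_less_iff:
  assumes "prefix P v"
  shows "length (longest_common_prefix u v) < length P \<longleftrightarrow> \<not> prefix P u"
  by (meson assms longest_common_prefix_max_prefix longest_common_prefix_prefix1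
      longest_common_prefix_prefix2 linorder_not_less prefix_length_le prefix_length_prefix
      prefix_order.trans)

lemma count_list_map_eq_length_filter:
  "count_list (map f xs) c = length (filter (\<lambda>x. f x = c) xs)"
  by (induction xs) auto

text \<open>Turns a rank into an index: the kept elements before position \<open>k\<close> are those
  that precede \<open>xs ! k\<close> in the filtered list.\<close>

lemma filter_nth_length_filter_take:
  assumes "k < length xs" "Q (xs ! k)"
  shows "filter Q xs ! length (filter Q (take k xs)) = xs ! k"
proof -
  have "filter Q xs = filter Q (take k xs @ xs ! k # drop (Suc k) xs)"
    using assms(1) by (simp add: id_take_nth_drop[symmetric])
  then show ?thesis
    using assms(2) by (simp add: nth_append)
qed

lemma rank_nth1:
  assumes "1 \<le> k" "k \<le> length X"
  shows "rank (X !\<^sub>1 k) X k = Suc (rank (X !\<^sub>1 k) X (k - 1))"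
  using assms by (cases k) (auto simp: rank_def nth1_def take_Suc_conv_app_nth)

lemma rank_eq_if_not_between:
  assumes "a \<le> b" "b \<le> length X" "\<And>k. a < k \<Longrightarrow> k \<le> b \<Longrightarrow> X !\<^sub>1 k \<noteq> c"
  shows "rank c X b = rank c X a"
  using assms
proof (induction b rule: dec_induct)
  case (step b)
  then have "rank c X b = rank c X a" by auto
  moreover have "X ! b \<noteq> c"
    using step.prems(2)[of "Suc b"] step.hyps by (simp add: nth1_def)
  ultimately show ?case
    using step.prems(1) by (simp add: rank_def take_Suc_conv_app_nth)
qed simp

section \<open>Documents and their terminators\<close>

text \<open>If the remainder \<open>z\<close> were nonempty, the \<open>d\<close> that ends
  \<open>u\<close> would lie inside \<open>b\<close>.\<close>

lemma is_document_prefix_eq: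
  assumes "is_document d u" "is_document d v" "prefix u v"
  shows "u = v"
proof -
  obtain a b z where ab: "u = a @ [d]" "v = b @ [d]" "d \<notin> set b" "v = u @ z"
    using assms by (auto simp: is_document_def prefix_def)
  then show ?thesis by (cases z rule: rev_cases) auto
qed

lemma is_document_suffix_from:
  assumes "is_document d S" "i \<in> {1..length S}"
  shows "is_document d (suffix_from S i)"
  using assms by (auto simp: is_document_def suffix_from_def dest: in_set_dropD)

text \<open>If \<open>P\<close> reached beyond \<open>u\<close>, it would contain the
  \<open>d\<close> that ends \<open>u\<close>.\<close>

lemma prefix_append_document_iff:
  assumes "is_document d u" "d \<notin> set P"
  shows "prefix P (u @ x) \<longleftrightarrow> prefix P u"
  using assms by (auto simp: is_document_def prefix_append)

section \<open>Locating documents in the concatenation\<close>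

definition offset :: "'a list list \<Rightarrow> nat \<Rightarrow> nat" where
  "offset docs j = length (concat (take (j - 1) docs))"

lemma concat_split_nth1:
  assumes "1 \<le> j" "j \<le> length docs"
  shows "concat docs = concat (take (j - 1) docs) @ docs !\<^sub>1 j @ concat (drop j docs)"
proof -
  have "docs = take (j - 1) docs @ docs ! (j - 1) # drop (Suc (j - 1)) docs"
    using assms by (intro id_take_nth_drop) auto
  then have "docs = take (j - 1) docs @ docs !\<^sub>1 j # drop j docs"
    using assms(1) by (simp add: nth1_def)
  from arg_cong[OF this, of concat] show ?thesis by simp
qed

text \<open>The two bounds in \<open>doc_of\<close> are the ends of document \<open>j\<close>, so
  the definite description becomes an interval test.\<close>

lemma doc_of_eq_iff:
  assumes "1 \<le> j" "j \<le> length docs" "1 \<le> p" "p \<le> length (concat docs)"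
  shows "doc_of docs p = j \<longleftrightarrow> offset docs j < p \<and> p \<le> offset docs j + length (docs !\<^sub>1 j)"
proof -
  have "length (concat (take j docs)) = offset docs j + length (docs !\<^sub>1 j)"
    using assms(1,2) by (cases j) (auto simp: offset_def nth1_def take_Suc_conv_app_nth)
  then show ?thesis
    using theI'[OF ex1_doc_of[OF assms(3,4)]] the1_equality[OF ex1_doc_of[OF assms(3,4)], of j] assms(1,2)
    unfolding doc_of_def[symmetric] offset_def by auto
qed

lemma doc_of_range:
  assumes "1 \<le> p" "p \<le> length (concat docs)"
  shows "1 \<le> doc_of docs p" "doc_of docs p \<le> length docs"
  using theI'[OF ex1_doc_of[OF assms]] unfolding doc_of_def[symmetric] by auto

lemma suffix_from_concat:
  assumes "1 \<le> j" "j \<le> length docs"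
    and "offset docs j < p" "p \<le> offset docs j + length (docs !\<^sub>1 j)"
  shows "suffix_from (concat docs) p =
    suffix_from (docs !\<^sub>1 j) (p - offset docs j) @ concat (drop j docs)"
  using assms(3,4) by (subst concat_split_nth1[OF assms(1,2)])
    (auto simp: suffix_from_def offset_def diff_diff_eq add.commute)

section \<open>Entries of suffix arrays and document arrays\<close>

lemma suffix_array_props:
  "distinct (suffix_array S)" "set (suffix_array S) = {1..length S}"
  "sorted_wrt (<) (map (suffix_from S) (suffix_array S))"
  using is_suffix_array_suffix_array[of S] unfolding is_suffix_array_iff by auto

lemma length_suffix_array [simp]: "length (suffix_array S) = length S"
  using distinct_card[OF suffix_array_props(1)[of S]] by (simp add: suffix_array_props(2))

lemma length_document_array [simp]: "length (document_array docs) = length (concat docs)"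
  unfolding document_array_def by (simp only: length_map length_suffix_array)

lemma suffix_array_nth1_range:
  assumes "1 \<le> k" "k \<le> length S"
  shows "1 \<le> suffix_array S !\<^sub>1 k" "suffix_array S !\<^sub>1 k \<le> length S"
proof -
  have "suffix_array S !\<^sub>1 k \<in> set (suffix_array S)"
    using assms by (auto simp: nth1_def)
  then show "1 \<le> suffix_array S !\<^sub>1 k" "suffix_array S !\<^sub>1 k \<le> length S"
    by (auto simp: suffix_array_props(2))
qed

lemma document_array_nth1:
  assumes "1 \<le> k" "k \<le> length (concat docs)"
  shows "document_array docs !\<^sub>1 k = doc_of docs (suffix_array (concat docs) !\<^sub>1 k)"
proof -
  have "k - 1 < length (suffix_array (concat docs))"
    using assms by (simp only: length_suffix_array)
  then show ?thesis by (simp only: document_array_def nth1_def nth_map)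
qed

section \<open>Single documents inside the suffix array of the concatenation\<close>

text \<open>Suffix arrays are unique, so it suffices that the shifted subsequence lists every
  position of document \<open>j\<close> once, in increasing order of suffixes.\<close>

lemma suffix_array_document:
  assumes docs: "\<And>S. S \<in> set docs \<Longrightarrow> is_document d S"
    and j: "1 \<le> j" "j \<le> length docs"
  shows "suffix_array (docs !\<^sub>1 j) =
    map (\<lambda>p. p - offset docs j) (filter (\<lambda>p. doc_of docs p = j) (suffix_array (concat docs)))"
    (is "suffix_array ?S = map ?f ?sa")
proof -
  let ?T = "concat docs" and ?o = "offset docs j"
  have doc: "is_document d ?S"
    using j by (intro docs) (auto simp: nth1_def)
  have len: "?o + length ?S \<le> length ?T"
    using arg_cong[OF concat_split_nth1[OF j], of length]
    by (simp only: offset_def length_append)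
  \<comment> \<open>\<open>doc_of\<close> is specified only on positions of the concatenation. Other
    \<open>p\<close> fail both sides, those that are too large because of
    \<open>len\<close>.\<close>
  have mem: "p \<in> set ?sa \<longleftrightarrow> ?o < p \<and> p \<le> ?o + length ?S" for p
  proof (cases "1 \<le> p \<and> p \<le> length ?T")
    case True
    then show ?thesis
      using doc_of_eq_iff[OF j, of p] by (simp add: suffix_array_props(2) del: length_concat)
  next
    case False
    then show ?thesis using len by (auto simp add: suffix_array_props(2) simp del: length_concat)
  qed
  \<comment> \<open>Truncated subtraction is injective here because all entries exceed the
    offset.\<close>
  have "inj_on ?f (set ?sa)"
    by (intro inj_onI) (use mem in \<open>metis less_imp_le eq_diff_iff\<close>)
  then have "distinct (map ?f ?sa)"
    using distinct_filter[OF suffix_array_props(1)] by (simp only: distinct_map simp_thms)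
  moreover have "set (map ?f ?sa) = {1..length ?S}"
  proof (intro set_eqI iffI)
    fix q assume "q \<in> set (map ?f ?sa)"
    then obtain p where "p \<in> set ?sa" "q = p - ?o" by (auto simp only: set_map)
    then show "q \<in> {1..length ?S}" using mem[of p] by auto
  next
    fix q assume "q \<in> {1..length ?S}"
    then have "q + ?o \<in> set ?sa" unfolding mem by auto
    then show "q \<in> set (map ?f ?sa)"
      unfolding set_map by (rule rev_image_eqI) simp
  qed
  moreover have "sorted_wrt (<) (map (suffix_from ?S) (map ?f ?sa))"
  proof -
    have "sorted_wrt (\<lambda>p q. suffix_from ?T p < suffix_from ?T q) ?sa"
      using suffix_array_props(3)[of ?T] unfolding sorted_wrt_map by (rule sorted_wrt_filter)
    then have "sorted_wrt (\<lambda>p q. suffix_from ?S (?f p) < suffix_from ?S (?f q)) ?sa"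
    proof (rule sorted_wrt_mono_rel[rotated])
      fix p q assume pq: "p \<in> set ?sa" "q \<in> set ?sa" "suffix_from ?T p < suffix_from ?T q"
      let ?u = "suffix_from ?S (?f p)" and ?v = "suffix_from ?S (?f q)"
      note p = pq(1)[unfolded mem] and q = pq(2)[unfolded mem]
      \<comment> \<open>Both suffixes of the concatenation continue with the same later
        documents.\<close>
      have less: "?u @ concat (drop j docs) < ?v @ concat (drop j docs)"
        using pq(3) p q by (simp add: suffix_from_concat[OF j])
      have uv: "is_document d ?u" "is_document d ?v"
        using p q by (auto intro!: is_document_suffix_from[OF doc])
      \<comment> \<open>A prefix relation would force \<open>?u = ?v\<close>, against the strict
        inequality \<open>less\<close>.\<close>
      have "\<not> prefix ?u ?v" "\<not> prefix ?v ?u"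
        using is_document_prefix_eq[OF uv] is_document_prefix_eq[OF uv(2,1)] less by auto
      then show "?u < ?v" using less by (rule append_less_append_imp_less)
    qed
    then show ?thesis by (simp only: sorted_wrt_map)
  qed
  ultimately have "is_suffix_array ?S (map ?f ?sa)"
    unfolding is_suffix_array_iff by blast
  then show ?thesis
    using ex1_suffix_array is_suffix_array_suffix_array by blast
qed

text \<open>The rank counts the entries of document \<open>j\<close> up to \<open>k\<close>, so it
  is the 1-based index of entry \<open>k\<close> in the subsequence for \<open>j\<close>.\<close>

lemma suffix_array_nth1_rank:
  assumes docs: "\<And>S. S \<in> set docs \<Longrightarrow> is_document d S"
    and k: "1 \<le> k" "k \<le> length (concat docs)" and j: "j = document_array docs !\<^sub>1 k"
  shows "suffix_array (docs !\<^sub>1 j) !\<^sub>1 rank j (document_array docs) k =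
      suffix_array (concat docs) !\<^sub>1 k - offset docs j" (is ?nth)
    and "rank j (document_array docs) k \<le> length (docs !\<^sub>1 j)" (is ?le)
proof -
  let ?sa = "suffix_array (concat docs)" and ?Q = "\<lambda>p. doc_of docs p = j"
  have Q: "?Q (?sa ! (k - 1))" and jr: "1 \<le> j" "j \<le> length docs"
    using document_array_nth1[OF k] doc_of_range[OF suffix_array_nth1_range[OF k]] j
    by (auto simp: nth1_def)
  have k': "k - 1 < length ?sa" using k by (simp only: length_suffix_array)
  have rank: "rank j (document_array docs) i = length (filter ?Q (take i ?sa))" for i
    by (simp only: rank_def document_array_def take_map count_list_map_eq_length_filter)
  have Suc: "rank j (document_array docs) k = Suc (length (filter ?Q (take (k - 1) ?sa)))"
    unfolding rank[of "k - 1", symmetric] unfolding j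
    by (rule rank_nth1) (use k in \<open>simp_all only: length_document_array\<close>)
  have "filter ?Q ?sa = filter ?Q (take k ?sa) @ filter ?Q (drop k ?sa)"
    by (simp flip: filter_append)
  then have le: "rank j (document_array docs) k \<le> length (filter ?Q ?sa)"
    by (simp add: rank)
  have sa: "suffix_array (docs !\<^sub>1 j) = map (\<lambda>p. p - offset docs j) (filter ?Q ?sa)"
    using docs jr by (rule suffix_array_document)
  show ?le using le arg_cong[OF sa, of length] by simp
  show ?nth
    unfolding sa
    using le filter_nth_length_filter_take[of "k - 1" ?sa ?Q, OF k' Q]
    by (simp add: nth1_def Suc)
qed

text \<open>The suffix of the concatenation is a suffix of document \<open>j\<close> followed by
  later documents, and \<open>P\<close> cannot extend past the closing \<open>d\<close>.\<close>

lemma prefix_suffix_at_iff: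
  assumes docs: "\<And>S. S \<in> set docs \<Longrightarrow> is_document d S"
    and k: "1 \<le> k" "k \<le> length (concat docs)" and j: "j = document_array docs !\<^sub>1 k"
    and P: "d \<notin> set P"
  shows "prefix P (suffix_from (concat docs) (suffix_array (concat docs) !\<^sub>1 k)) \<longleftrightarrow>
    prefix P (suffix_from (docs !\<^sub>1 j) (suffix_array (docs !\<^sub>1 j) !\<^sub>1 rank j (document_array docs) k))"
proof -
  let ?p = "suffix_array (concat docs) !\<^sub>1 k" and ?o = "offset docs j"
  note pr = suffix_array_nth1_range[OF k]
  have jp: "j = doc_of docs ?p" using j document_array_nth1[OF k] by simp
  note jr = doc_of_range[OF pr, folded jp]
  have o: "?o < ?p" "?p \<le> ?o + length (docs !\<^sub>1 j)"
    using doc_of_eq_iff[OF jr pr] jp by auto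
  have "is_document d (docs !\<^sub>1 j)" using jr by (intro docs) (auto simp: nth1_def)
  then have "is_document d (suffix_from (docs !\<^sub>1 j) (?p - ?o))"
    by (rule is_document_suffix_from) (use o in auto)
  then show ?thesis
    using prefix_append_document_iff P
    by (simp only: suffix_array_nth1_rank(1)[OF docs k j] suffix_from_concat[OF jr o])
qed

section \<open>ILCP entries and pattern intervals\<close>

lemma ilcp_array_nth1:
  assumes docs: "\<And>S. S \<in> set docs \<Longrightarrow> is_document d S"
    and k: "1 \<le> k" "k \<le> length (concat docs)" and j: "j = document_array docs !\<^sub>1 k"
    and i: "i = rank j (document_array docs) k"
  shows "ilcp_array docs !\<^sub>1 k = (if i = 1 then 0 else length (longest_common_prefix
    (suffix_from (docs !\<^sub>1 j) (suffix_array (docs !\<^sub>1 j) !\<^sub>1 (i - 1)))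
    (suffix_from (docs !\<^sub>1 j) (suffix_array (docs !\<^sub>1 j) !\<^sub>1 i))))"
proof -
  \<comment> \<open>Position \<open>k\<close> counts itself; with the upper bound below, the access
    to \<open>lcp_array\<close> is in range.\<close>
  have "1 \<le> i" using rank_nth1[of k "document_array docs"] k i j by (simp del: length_concat)
  moreover have "i \<le> length (docs !\<^sub>1 j)"
    unfolding i by (rule suffix_array_nth1_rank(2)[OF docs k j])
  ultimately have "lcp_array (docs !\<^sub>1 j) !\<^sub>1 i = (if i = 1 then 0 else length (longest_common_prefix
    (suffix_from (docs !\<^sub>1 j) (suffix_array (docs !\<^sub>1 j) !\<^sub>1 (i - 1)))
    (suffix_from (docs !\<^sub>1 j) (suffix_array (docs !\<^sub>1 j) !\<^sub>1 i))))"
    by (simp add: lcp_array_def nth1_def del: upt_Suc)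
  moreover have "ilcp_array docs !\<^sub>1 k = lcp_array (docs !\<^sub>1 j) !\<^sub>1 i"
  proof -
    have "k - 1 < length [1..<length (concat docs) + 1]" "[1..<length (concat docs) + 1] ! (k - 1) = k"
      using k by (auto simp del: upt_Suc length_concat)
    then show ?thesis by (simp only: ilcp_array_def nth1_def nth_map Let_def i j)
  qed
  ultimately show ?thesis by simp
qed

text \<open>The interval is defined by a set of text positions; distinctness of the suffix array
  carries this over to indices.\<close>

lemma is_sa_interval_iff:
  assumes int: "is_sa_interval T P l r" and k: "1 \<le> k" "k \<le> length T"
  shows "prefix P (suffix_from T (suffix_array T !\<^sub>1 k)) \<longleftrightarrow> l \<le> k \<and> k \<le> r"
proof -
  let ?sa = "suffix_array T"
  have lr: "1 \<le> l" "r \<le> length T" using int by (auto simp: is_sa_interval_def)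
  have "prefix P (suffix_from T (?sa !\<^sub>1 k)) \<longleftrightarrow> ?sa !\<^sub>1 k \<in> {?sa !\<^sub>1 k' | k'. l \<le> k' \<and> k' \<le> r}"
    using int suffix_array_nth1_range[OF k] unfolding is_sa_interval_def by auto
  also have "\<dots> \<longleftrightarrow> (\<exists>k'. l \<le> k' \<and> k' \<le> r \<and> ?sa !\<^sub>1 k' = ?sa !\<^sub>1 k)"
    by auto metis
  also have "\<dots> \<longleftrightarrow> l \<le> k \<and> k \<le> r"
  proof -
    have "k' = k" if "l \<le> k'" "k' \<le> r" "?sa !\<^sub>1 k' = ?sa !\<^sub>1 k" for k'
    proof -
      have "k' - 1 = k - 1"
        using that lr k nth_eq_iff_index_eq[OF suffix_array_props(1)[of T], of "k' - 1" "k - 1"]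
        by (simp add: nth1_def)
      then show ?thesis using that(1) lr(1) k(1) by linarith
    qed
    then show ?thesis by auto
  qed
  finally show ?thesis .
qed

theorem lemma1:
  fixes dollar :: "'a::linorder" and docs :: "'a list list" and T P :: "'a list" and l r m :: nat
  assumes "\<And>c. c \<noteq> dollar \<Longrightarrow> dollar < c"
    and "\<And>S. S \<in> set docs \<Longrightarrow> is_document dollar S"
    and "T = concat docs"
    and "dollar \<notin> set P"
    and "length P = m"
    and "m \<ge> 1"
    and "is_sa_interval T P l r"
  shows "\<forall>k. l \<le> k \<and> k \<le> r \<longrightarrow>
    (ilcp_array docs !\<^sub>1 k < m \<longleftrightarrow>
     (\<forall>k'. l \<le> k' \<and> k' < k \<longrightarrow> document_array docs !\<^sub>1 k' \<noteq> document_array docs !\<^sub>1 k))"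
proof (intro allI impI)
  fix k assume k: "l \<le> k \<and> k \<le> r"
  have lr: "1 \<le> l" "r \<le> length (concat docs)"
    using assms(3,7) unfolding is_sa_interval_def by auto
  with k have k1: "1 \<le> k" "k \<le> length (concat docs)" by linarith+
  define DA where "DA = document_array docs"
  define j where "j = DA !\<^sub>1 k"
  let ?suf = "\<lambda>i. suffix_from (docs !\<^sub>1 j) (suffix_array (docs !\<^sub>1 j) !\<^sub>1 i)"
  have len: "length DA = length (concat docs)"
    unfolding DA_def by (rule length_document_array)
  have rank_k: "rank j DA k = Suc (rank j DA (k - 1))"
    unfolding j_def using k1 by (intro rank_nth1) (simp_all only: len)
  have ilcp: "ilcp_array docs !\<^sub>1 k = (if rank j DA k = 1 then 0
      else length (longest_common_prefix (?suf (rank j DA k - 1)) (?suf (rank j DA k))))"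
    by (rule ilcp_array_nth1[of docs dollar, OF assms(2) k1]) (simp_all add: j_def DA_def)
  \<comment> \<open>Membership in the interval becomes a test on suffixes of document
    \<open>j\<close> alone, which are all that ILCP sees.\<close>
  have pre: "prefix P (?suf (rank j DA k')) \<longleftrightarrow> l \<le> k' \<and> k' \<le> r"
    if "1 \<le> k'" "k' \<le> length (concat docs)" "DA !\<^sub>1 k' = j" for k'
    using prefix_suffix_at_iff[of docs dollar k' j P, OF assms(2) that(1,2) _ assms(4)]
      is_sa_interval_iff[OF assms(7)[unfolded assms(3)] that(1,2)] that(3)
    unfolding DA_def by blast
  have "ilcp_array docs !\<^sub>1 k < m \<longleftrightarrow> (\<forall>k'. l \<le> k' \<and> k' < k \<longrightarrow> DA !\<^sub>1 k' \<noteq> j)"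
  \<comment> \<open>The split ranges over all indices from 1, not from \<open>l\<close>, because
    \<open>rank\<close> counts from the start of the array.\<close>
  proof (cases "\<exists>k'. 1 \<le> k' \<and> k' < k \<and> DA !\<^sub>1 k' = j")
    case False
    then have "rank j DA (k - 1) = rank j DA 0"
    proof (intro rank_eq_if_not_between)
      show "DA !\<^sub>1 k' \<noteq> j" if "0 < k'" "k' \<le> k - 1" for k'
        using False[simplified, rule_format, of k'] that k1(1) by simp
    qed (use k1 len in linarith)+
    then have "rank j DA k = 1" using rank_k by (simp add: rank_def)
    \<comment> \<open>The value is the default 0 of the first LCP entry, which is below
      \<open>m\<close> since \<open>m \<ge> 1\<close>.\<close>
    then show ?thesis using ilcp assms(6) False lr(1) by auto
  next
    case True
    define k0 where "k0 = (GREATEST k'. 1 \<le> k' \<and> k' < k \<and> DA !\<^sub>1 k' = j)"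
    have bound: "k' \<le> k" if "1 \<le> k' \<and> k' < k \<and> DA !\<^sub>1 k' = j" for k' using that by simp
    have k0: "1 \<le> k0" "k0 < k" "DA !\<^sub>1 k0 = j"
      using GreatestI_ex_nat[OF True bound] unfolding k0_def by blast+
    have max: "k' \<le> k0" if "1 \<le> k'" "k' < k" "DA !\<^sub>1 k' = j" for k'
      unfolding k0_def by (rule Greatest_le_nat[OF _ bound]) (use that in auto)
    \<comment> \<open>By maximality \<open>j\<close> does not occur strictly between
      \<open>k0\<close> and \<open>k\<close>, so \<open>k0\<close> belongs to the preceding suffix
      of the document.\<close>
    have "rank j DA (k - 1) = rank j DA k0"
    proof (rule rank_eq_if_not_between)
      show "DA !\<^sub>1 k' \<noteq> j" if "k0 < k'" "k' \<le> k - 1" for k'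
        using max[of k'] that by fastforce
    qed (use k0 k1 len in linarith)+
    \<comment> \<open>This excludes the default case \<open>rank j DA k = 1\<close>.\<close>
    moreover have "rank j DA k0 \<noteq> 0"
      using rank_nth1[of k0 DA] k0 k1 len by simp
    ultimately have "ilcp_array docs !\<^sub>1 k =
        length (longest_common_prefix (?suf (rank j DA k0)) (?suf (rank j DA k)))"
      using ilcp rank_k by simp
    moreover have "prefix P (?suf (rank j DA k))"
      using pre[of k] k k1 j_def by simp
    ultimately have "ilcp_array docs !\<^sub>1 k < m \<longleftrightarrow> \<not> prefix P (?suf (rank j DA k0))"
      using length_longest_common_prefix_less_iff assms(5) by metis
    \<comment> \<open>The upper bound is automatic, since \<open>k0 < k \<le> r\<close>.\<close>
    also have "\<dots> \<longleftrightarrow> \<not> l \<le> k0"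
      using pre[of k0] k0 k k1 by linarith
    \<comment> \<open>Any earlier occurrence is at most \<open>k0\<close>, so none lies in the
      interval if \<open>k0 < l\<close>; otherwise \<open>k0\<close> is one.\<close>
    also have "\<dots> \<longleftrightarrow> (\<forall>k'. l \<le> k' \<and> k' < k \<longrightarrow> DA !\<^sub>1 k' \<noteq> j)"
    proof
      show "\<forall>k'. l \<le> k' \<and> k' < k \<longrightarrow> DA !\<^sub>1 k' \<noteq> j" if "\<not> l \<le> k0"
      proof (intro allI impI notI)
        fix k' assume "l \<le> k' \<and> k' < k" "DA !\<^sub>1 k' = j"
        then show False using max[of k'] that lr(1) by linarith
      qed
    qed (use k0 in blast)
    finally show ?thesis .
  qed
  then show "ilcp_array docs !\<^sub>1 k < m \<longleftrightarrow>
     (\<forall>k'. l \<le> k' \<and> k' < k \<longrightarrow> document_array docs !\<^sub>1 k' \<noteq> document_array docs !\<^sub>1 k)"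
    unfolding j_def DA_def .
qed

end
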